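(* Let $G$ be a finite bipartite graph. Then $\alpha(G)=a(G)$ if and only if $\alpha'(G)=a(G)$.
   Context: All graphs are finite and simple. $\alpha(G)$ denotes the independence number of $G$. For a set $S$ of vertices, $\mathcal{N}(S)$ denotes the set of vertices adjacent to at least one vertex of $S$. An independent set $I$ is critical if $|I|-|\mathcal{N}(I)|$ is maximum among all independent sets of $G$; the critical independence number $\alpha'(G)$ is the maximum cardinality of a critical independent set. The annihilation number $a(G)$: if $d_1\leq \dots\leq d_n$ are the vertex degrees of $G$ in nondecreasing order, $a(G)$ is the largest $k$ such that $\sum_{i=1}^k d_i\leq |E(G)|$. *)

theory Defs
  imports "HOL-Library.Multiset"
begin

locale finite_simple_graph =
  fixes V :: "'a set" and E :: "'a set set"
  assumes finite_vertices: "finite V"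
    and edges_are_pairs: "e \<in> E \<Longrightarrow> e \<subseteq> V \<and> card e = 2"

definition bipartite :: "'a set \<Rightarrow> 'a set set \<Rightarrow> bool" where
  "bipartite V E \<longleftrightarrow>
     (\<exists>A B. A \<union> B = V \<and> A \<inter> B = {} \<and> (\<forall>e\<in>E. \<exists>a\<in>A. \<exists>b\<in>B. e = {a, b}))"

definition neighborhood :: "'a set \<Rightarrow> 'a set set \<Rightarrow> 'a set \<Rightarrow> 'a set" where
  "neighborhood V E S = {v \<in> V. \<exists>u\<in>S. {u, v} \<in> E}"

definition vertex_degree :: "'a set \<Rightarrow> 'a set set \<Rightarrow> 'a \<Rightarrow> nat" where
  "vertex_degree V E v = card {u \<in> V. {u, v} \<in> E}"

definition independent_set :: "'a set \<Rightarrow> 'a set set \<Rightarrow> 'a set \<Rightarrow> bool" where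
  "independent_set V E I \<longleftrightarrow> I \<subseteq> V \<and> (\<forall>u\<in>I. \<forall>v\<in>I. {u, v} \<notin> E)"

definition independence_number :: "'a set \<Rightarrow> 'a set set \<Rightarrow> nat" where
  "independence_number V E = Max {card I | I. independent_set V E I}"

text \<open>The difference may be negative, hence the integers.\<close>

definition critical_difference :: "'a set \<Rightarrow> 'a set set \<Rightarrow> 'a set \<Rightarrow> int" where
  "critical_difference V E I = int (card I) - int (card (neighborhood V E I))"

definition critical_independent_set :: "'a set \<Rightarrow> 'a set set \<Rightarrow> 'a set \<Rightarrow> bool" where
  "critical_independent_set V E I \<longleftrightarrow> independent_set V E I \<and>
     (\<forall>J. independent_set V E J \<longrightarrow> critical_difference V E J \<le> critical_difference V E I)"

definition critical_independence_number :: "'a set \<Rightarrow> 'a set set \<Rightarrow> nat" where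
  "critical_independence_number V E = Max {card I | I. critical_independent_set V E I}"

definition degree_sequence :: "'a set \<Rightarrow> 'a set set \<Rightarrow> nat list" where
  "degree_sequence V E = sorted_list_of_multiset (image_mset (vertex_degree V E) (mset_set V))"

text \<open>The bound \<open>k \<le> card V\<close> is needed because \<open>take k\<close> is the whole list for every larger \<open>k\<close>.\<close>

definition annihilation_number :: "'a set \<Rightarrow> 'a set set \<Rightarrow> nat" where
  "annihilation_number V E =
     Max {k. k \<le> card V \<and> sum_list (take k (degree_sequence V E)) \<le> card E}"

end

theory Submission
  imports Defs
begin

text \<open>In a bipartite graph every maximum independent set is critical, so the two independence
  numbers coincide. Indeed, let \<open>A\<close>, \<open>B\<close> be the sides and let \<open>J\<close> be independent. Both
  \<open>(J \<inter> A) \<union> (B - N(J \<inter> A))\<close> and \<open>(J \<inter> B) \<union> (A - N(J \<inter> B))\<close> are independent, and their sizes add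
  up to \<open>|J| - |N(J)| + |V|\<close>. Hence \<open>|J| - |N(J)| \<le> 2\<alpha> - |V|\<close>, whereas a maximum independent set
  \<open>I\<close> satisfies \<open>N(I) \<subseteq> V - I\<close> and therefore \<open>|I| - |N(I)| \<ge> 2\<alpha> - |V|\<close>.\<close>

lemma neighborhood_Un:
  "neighborhood V E (S \<union> T) = neighborhood V E S \<union> neighborhood V E T"
  by (auto simp: neighborhood_def)

text \<open>The parameter \<open>P\<close> lets one lemma serve both maxima: a trivial
  \<open>P\<close> for the independence number, maximality of the difference for the critical
  one.\<close>

lemma finite_independent_cards:
  assumes "finite V"
  shows "finite {card I | I. independent_set V E I \<and> P I}"
proof -
  have "{card I | I. independent_set V E I \<and> P I} \<subseteq> card ` Pow V"
    by (auto simp: independent_set_def)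
  then show ?thesis
    using assms finite_subset by blast
qed

lemma card_le_independence_number:
  assumes "finite V" "independent_set V E I"
  shows "card I \<le> independence_number V E"
  unfolding independence_number_def
  using finite_independent_cards[OF assms(1), of E "\<lambda>_. True"] assms(2)
  by (intro Max_ge) auto

lemma maximum_independent_set_exists:
  assumes "finite V"
  obtains I where "independent_set V E I" "card I = independence_number V E"
proof -
  have "independent_set V E {}"
    by (simp add: independent_set_def)
  then have "independence_number V E \<in> {card I | I. independent_set V E I}"
    unfolding independence_number_def
    using finite_independent_cards[OF assms, of E "\<lambda>_. True"]
    by (intro Max_in) auto
  then show thesis
    using that by auto
qed

lemma critical_difference_ge:
  assumes "finite V" "independent_set V E I"
  shows "critical_difference V E I \<ge> 2 * int (card I) - int (card V)"
proof -
  have "I \<subseteq> V" and "neighborhood V E I \<subseteq> V - I"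
    using assms(2) by (auto simp: independent_set_def neighborhood_def)
  \<comment> \<open>The second bound makes the natural subtraction exact, so that it carries over to
    the integers.\<close>
  then have "card (neighborhood V E I) \<le> card V - card I" and "card I \<le> card V"
    using assms(1) by (metis card_Diff_subset card_mono finite_Diff finite_subset)
      (use \<open>I \<subseteq> V\<close> assms(1) card_mono in blast)
  then show ?thesis
    by (simp add: critical_difference_def)
qed

text \<open>Start from the independent side \<open>B\<close> and add \<open>S\<close>: the only
  vertices that must leave are the neighbours of \<open>S\<close>, all of which lie in
  \<open>B\<close>.\<close>

lemma exchange_across_bipartition:
  assumes "finite V" "A \<union> B = V" "A \<inter> B = {}"
    and edges: "\<forall>e\<in>E. \<exists>a\<in>A. \<exists>b\<in>B. e = {a, b}"
    and "S \<subseteq> A"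
  shows "neighborhood V E S \<subseteq> B"
    and "int (card S) + int (card B) - int (card (neighborhood V E S))
           \<le> int (independence_number V E)"
proof -
  have cross: "(u \<in> A \<and> v \<in> B) \<or> (u \<in> B \<and> v \<in> A)" if "{u, v} \<in> E" for u v
    using edges that by (fastforce simp: doubleton_eq_iff)
  show nb: "neighborhood V E S \<subseteq> B"
    using cross assms(3,5) by (fastforce simp: neighborhood_def)
  have fin: "finite A" "finite B"
    using assms(1,2) by auto
  let ?I = "S \<union> (B - neighborhood V E S)"
  have "independent_set V E ?I"
    unfolding independent_set_def
  proof (intro conjI ballI notI)
    show "?I \<subseteq> V"
      using assms(2,5) by auto
    fix u v assume "u \<in> ?I" "v \<in> ?I" "{u, v} \<in> E"
    \<comment> \<open>\<open>neighborhood\<close> puts the member of \<open>S\<close> first in the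
      edge; the flipped edge covers the case where that member is \<open>v\<close>.\<close>
    moreover from this have "{v, u} \<in> E"
      by (simp add: insert_commute)
    ultimately show False
      using cross[of u v] assms(2,3,5) by (auto simp: neighborhood_def)
  qed
  then have "card ?I \<le> independence_number V E"
    using assms(1) by (rule card_le_independence_number[rotated])
  moreover have "card ?I = card S + (card B - card (neighborhood V E S))"
  proof -
    have "card ?I = card S + card (B - neighborhood V E S)"
      using fin assms(3,5) by (intro card_Un_disjoint) (auto intro: finite_subset)
    also have "card (B - neighborhood V E S) = card B - card (neighborhood V E S)"
      using nb fin by (intro card_Diff_subset) (auto intro: finite_subset)
    finally show ?thesis .
  qed
  \<comment> \<open>Truncated subtraction is harmless here: it never falls below the integer
    difference.\<close>
  ultimately show "int (card S) + int (card B) - int (card (neighborhood V E S))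
           \<le> int (independence_number V E)"
    by linarith
qed

lemma bipartite_critical_difference_le:
  assumes "finite V" "bipartite V E" "independent_set V E J"
  shows "critical_difference V E J \<le> 2 * int (independence_number V E) - int (card V)"
proof -
  obtain A B where AB: "A \<union> B = V" "A \<inter> B = {}"
    and edges: "\<forall>e\<in>E. \<exists>a\<in>A. \<exists>b\<in>B. e = {a, b}"
    using assms(2) by (auto simp: bipartite_def)
  \<comment> \<open>The exchange lemma treats the sides asymmetrically, so its premises are restated
    with the roles swapped.\<close>
  have BA: "B \<union> A = V" "B \<inter> A = {}" and edges': "\<forall>e\<in>E. \<exists>b\<in>B. \<exists>a\<in>A. e = {b, a}"
    using AB edges by (auto, metis insert_commute)
  note left = exchange_across_bipartition[OF assms(1) AB edges, of "J \<inter> A"]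
  note right = exchange_across_bipartition[OF assms(1) BA edges', of "J \<inter> B"]
  have fin: "finite A" "finite B"
    using assms(1) AB(1) by auto
  have J: "J = (J \<inter> A) \<union> (J \<inter> B)"
    using assms(3) AB(1) by (auto simp: independent_set_def)
  have "card J = card (J \<inter> A) + card (J \<inter> B)"
    using fin AB(2) by (subst J, intro card_Un_disjoint) auto
  \<comment> \<open>The two neighbourhoods lie on opposite sides, so they are disjoint and their
    sizes add.\<close>
  moreover have "card (neighborhood V E J)
      = card (neighborhood V E (J \<inter> A)) + card (neighborhood V E (J \<inter> B))"
    using left(1) right(1) fin AB(2)
    by (subst J, unfold neighborhood_Un, intro card_Un_disjoint) (auto intro: finite_subset)
  moreover have "card V = card A + card B"
    using fin AB by (metis card_Un_disjoint)
  ultimately show ?thesis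
    using left(2) right(2) by (simp add: critical_difference_def)
qed

lemma bipartite_maximum_independent_set_critical:
  assumes "finite V" "bipartite V E"
    and "independent_set V E I" "card I = independence_number V E"
  shows "critical_independent_set V E I"
  unfolding critical_independent_set_def
  using assms bipartite_critical_difference_le[OF assms(1,2)] critical_difference_ge[OF assms(1,3)]
  by fastforce

lemma bipartite_critical_independence_number_eq:
  assumes "finite V" "bipartite V E"
  shows "critical_independence_number V E = independence_number V E"
  unfolding critical_independence_number_def
proof (rule Max_eqI)
  show "finite {card I | I. critical_independent_set V E I}"
    unfolding critical_independent_set_def by (rule finite_independent_cards[OF assms(1)])
  \<comment> \<open>Critical sets are independent, which gives \<alpha>' \<le> \<alpha>; a critical
    maximum independent set then attains the bound.\<close>
  show "k \<le> independence_number V E" if "k \<in> {card I | I. critical_independent_set V E I}" for k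
    using that card_le_independence_number[OF assms(1)]
    by (auto simp: critical_independent_set_def)
  obtain I where "independent_set V E I" "card I = independence_number V E"
    using maximum_independent_set_exists[OF assms(1)] .
  then show "independence_number V E \<in> {card I | I. critical_independent_set V E I}"
    using bipartite_maximum_independent_set_critical[OF assms] by (metis (mono_tags) mem_Collect_eq)
qed

theorem theorem5:
  fixes V :: "'a set" and E :: "'a set set"
  assumes "finite_simple_graph V E"
    and "bipartite V E"
  shows "independence_number V E = annihilation_number V E \<longleftrightarrow>
         critical_independence_number V E = annihilation_number V E"
  using bipartite_critical_independence_number_eq[OF _ assms(2)]
    finite_simple_graph.finite_vertices[OF assms(1)] by simp

end
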